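(* Let $E$ be a complete separable metric space. Then there exists a countable set $\{\pi_n\}_{n\in\mathbb{N}}\subset\operatorname{Lip_b}(E,\mathbb{R})$ such that for every $\pi\in\operatorname{Lip}(E,\mathbb{R})$ there exists a subsequence $\{\pi_{n_k}\}_{k\in\mathbb{N}}\subset\{\pi_n\}_{n\in\mathbb{N}}$ such that $\pi_{n_k}(x)\to\pi(x)$ as $k\to\infty$ for every $x\in E$, and $\operatorname{Lip}(\pi_{n_k})\to\operatorname{Lip}(\pi)$ as $k\to\infty$. (That is, $\operatorname{Lip}(E,\mathbb{R})$ is separable in the topology of pointwise convergence and convergence of Lipschitz constants.) Furthermore, the subsequence may be chosen so that $\operatorname{Lip}(\pi_{n_k})\le\operatorname{Lip}(\pi)$ for all $k$. If in addition $\pi\in\operatorname{Lip_b}(E,\mathbb{R})$, then the subsequence may be chosen such that also $\|\pi_{n_k}\|_\infty\le\|\pi\|_\infty$ for all $k$ and $\|\pi_{n_k}\|_\infty\to\|\pi\|_\infty$ as $k\to\infty$.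
   Context: $\operatorname{Lip}(E,\mathbb{R})$ is the set of Lipschitz functions $E\to\mathbb{R}$, $\operatorname{Lip_b}(E,\mathbb{R})$ the subset of bounded ones, $\operatorname{Lip}(\pi)$ the (smallest) Lipschitz constant of $\pi$, and $\|\cdot\|_\infty$ the supremum norm. *)

theory Defs
  imports "HOL-Analysis.Analysis"
begin

text \<open>
  A metric space is a value of type \<open>'a metric\<close>, with carrier \<open>mspace E\<close>. Real functions on it are
  represented by total functions of type \<open>'a \<Rightarrow> real\<close>; only their values on \<open>mspace E\<close> are relevant.
\<close>

definition Lip :: "'a metric \<Rightarrow> ('a \<Rightarrow> real) set" where
  "Lip E = {f. Lipschitz_continuous_map E euclidean_metric f}"

definition Lip_b :: "'a metric \<Rightarrow> ('a \<Rightarrow> real) set" where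
  "Lip_b E = {f \<in> Lip E. bounded (f ` mspace E)}"

text \<open>
  The condition \<open>0 \<le> L\<close> matters only when \<open>E\<close> has at most one point. For a Lipschitz function the
  infimum is attained, so this is the smallest Lipschitz constant: see \<open>lip_const_least\<close>.
\<close>

definition lip_const :: "'a metric \<Rightarrow> ('a \<Rightarrow> real) \<Rightarrow> real" where
  "lip_const E f =
     Inf {L. 0 \<le> L \<and> (\<forall>x\<in>mspace E. \<forall>y\<in>mspace E. \<bar>f x - f y\<bar> \<le> L * mdist E x y)}"

text \<open>Meaningful only for functions that are bounded on a nonempty carrier.\<close>

definition sup_norm :: "'a metric \<Rightarrow> ('a \<Rightarrow> real) \<Rightarrow> real" where
  "sup_norm E f = (SUP x\<in>mspace E. \<bar>f x\<bar>)"

lemma lip_const_least: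
  assumes "f \<in> Lip E"
  shows "0 \<le> lip_const E f"
    and "\<And>x y. x \<in> mspace E \<Longrightarrow> y \<in> mspace E \<Longrightarrow> \<bar>f x - f y\<bar> \<le> lip_const E f * mdist E x y"
    and "\<And>L. 0 \<le> L \<Longrightarrow> (\<And>x y. x \<in> mspace E \<Longrightarrow> y \<in> mspace E \<Longrightarrow> \<bar>f x - f y\<bar> \<le> L * mdist E x y)
           \<Longrightarrow> lip_const E f \<le> L"
proof -
  define S where
    "S = {L. 0 \<le> L \<and> (\<forall>x\<in>mspace E. \<forall>y\<in>mspace E. \<bar>f x - f y\<bar> \<le> L * mdist E x y)}"
  have eq: "lip_const E f = Inf S"
    by (simp add: lip_const_def S_def)
  have bdd: "bdd_below S"
    by (rule bdd_belowI[of _ 0]) (simp add: S_def)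
  obtain B where B: "\<And>x y. x \<in> mspace E \<Longrightarrow> y \<in> mspace E \<Longrightarrow> \<bar>f x - f y\<bar> \<le> B * mdist E x y"
    using assms by (auto simp: Lip_def Lipschitz_continuous_map_def dist_real_def)
  have "\<bar>B\<bar> \<in> S"
    unfolding S_def
  proof (intro CollectI conjI ballI)
    fix x y assume "x \<in> mspace E" "y \<in> mspace E"
    then have "\<bar>f x - f y\<bar> \<le> B * mdist E x y" by (rule B)
    also have "\<dots> \<le> \<bar>B\<bar> * mdist E x y" by (intro mult_right_mono) auto
    finally show "\<bar>f x - f y\<bar> \<le> \<bar>B\<bar> * mdist E x y" .
  qed simp
  then have ne: "S \<noteq> {}" by blast
  show "0 \<le> lip_const E f"
    unfolding eq using ne by (rule cInf_greatest) (simp add: S_def)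
  show "lip_const E f \<le> L"
    if "0 \<le> L" "\<And>x y. x \<in> mspace E \<Longrightarrow> y \<in> mspace E \<Longrightarrow> \<bar>f x - f y\<bar> \<le> L * mdist E x y" for L
    unfolding eq by (rule cInf_lower[OF _ bdd]) (use that in \<open>simp add: S_def\<close>)
  show "\<bar>f x - f y\<bar> \<le> lip_const E f * mdist E x y" if xy: "x \<in> mspace E" "y \<in> mspace E" for x y
  proof (cases "x = y")
    case True
    then show ?thesis using xy by (simp add: Metric_space.mdist_zero[OF Metric_space_mspace_mdist])
  next
    case False
    then have pos: "0 < mdist E x y"
      using xy by (metis Metric_space.mdist_pos_eq[OF Metric_space_mspace_mdist])
    have "\<bar>f x - f y\<bar> / mdist E x y \<le> Inf S"
      using ne by (rule cInf_greatest) (use xy pos in \<open>auto simp: S_def divide_simps\<close>)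
    then show ?thesis using pos unfolding eq by (simp add: divide_simps)
  qed
qed

end

theory Submission
  imports Defs
begin

text \<open>
  The approximants are McShane extensions of rational data. For a countable dense set \<open>c 0, c 1, \<dots>\<close>
  take the functions \<open>x \<mapsto> min\<^sub>i (r\<^sub>i + l * d (c i) x)\<close> with finitely many indices \<open>i\<close>, truncated to
  \<open>[- m, m]\<close>, where \<open>l\<close>, \<open>m\<close> and all \<open>r\<^sub>i\<close> are rational. They form a countable family. Each of them
  has Lipschitz constant at most \<open>\<bar>l\<bar>\<close> and is bounded by \<open>\<bar>m\<bar>\<close>. Given a Lipschitz \<open>\<pi>\<close>, choosing \<open>l\<close> at or
  just below \<open>lip_const E \<pi>\<close>, \<open>m\<close> at or just below \<open>sup_norm E \<pi>\<close> (or just large, when \<open>\<pi>\<close> is unbounded)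
  and \<open>r\<^sub>i\<close> near \<open>\<pi> (c i)\<close> makes such a function close to \<open>\<pi>\<close> at any prescribed finite set of the
  points \<open>c i\<close> (\<open>rational_cones_approximate\<close>). All one-sided bounds hold by construction.

  The remaining assertions are soft. Functions with a common Lipschitz constant that converge on a
  dense set converge everywhere (\<open>pointwise_limit_from_dense\<close>). Both the Lipschitz constant and
  the supremum norm are lower semicontinuous under pointwise convergence, so together with the upper
  bounds they converge (\<open>lip_const_tendsto\<close>, \<open>sup_norm_tendsto\<close>). A subsequence must have
  strictly increasing indices, which is arranged by listing every member of the family infinitely often.
\<close>

section \<open>Lipschitz constants and supremum norms\<close>

lemma LipI:
  assumes "\<And>x y. x \<in> mspace E \<Longrightarrow> y \<in> mspace E \<Longrightarrow> \<bar>f x - f y\<bar> \<le> L * mdist E x y"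
  shows "f \<in> Lip E"
  using assms by (auto simp: Lip_def Lipschitz_continuous_map_def dist_real_def)

lemma Lip_bI:
  assumes "f \<in> Lip E" and "\<And>x. x \<in> mspace E \<Longrightarrow> \<bar>f x\<bar> \<le> B"
  shows "f \<in> Lip_b E"
  using assms by (auto simp: Lip_b_def bounded_iff)

lemma abs_le_sup_norm:
  assumes "f \<in> Lip_b E" and "x \<in> mspace E"
  shows "\<bar>f x\<bar> \<le> sup_norm E f"
proof -
  obtain B where "\<And>x. x \<in> mspace E \<Longrightarrow> \<bar>f x\<bar> \<le> B"
    using assms(1) by (auto simp: Lip_b_def bounded_iff)
  then have "bdd_above ((\<lambda>x. \<bar>f x\<bar>) ` mspace E)"
    by (rule bdd_aboveI2)
  then show ?thesis
    unfolding sup_norm_def using assms(2) by (intro cSUP_upper)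
qed

lemma sup_norm_le:
  assumes "mspace E \<noteq> {}" and "\<And>x. x \<in> mspace E \<Longrightarrow> \<bar>f x\<bar> \<le> B"
  shows "sup_norm E f \<le> B"
  unfolding sup_norm_def using assms by (intro cSUP_least)

text \<open>
  A strict lower bound \<open>a\<close> for the Lipschitz constant of the limit is witnessed by a single pair of
  points, and the difference at these two points passes to the limit.
\<close>

lemma lip_const_tendsto:
  assumes f: "f \<in> Lip E" and g: "\<And>k. g k \<in> Lip E"
    and conv: "\<And>x. x \<in> mspace E \<Longrightarrow> (\<lambda>k. g k x) \<longlonglongrightarrow> f x"
    and le: "\<And>k. lip_const E (g k) \<le> lip_const E f"
  shows "(\<lambda>k. lip_const E (g k)) \<longlonglongrightarrow> lip_const E f"
proof (rule order_tendstoI)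
  fix a assume "lip_const E f < a"
  then show "eventually (\<lambda>k. lip_const E (g k) < a) sequentially"
    using le by (intro always_eventually allI) (metis le_less_trans)
next
  fix a assume a: "a < lip_const E f"
  show "eventually (\<lambda>k. a < lip_const E (g k)) sequentially"
  proof (cases "a < 0")
    case True
    then show ?thesis
      using lip_const_least(1)[OF g] by (intro always_eventually allI) (metis less_le_trans)
  next
    case False
    then obtain x y where xy: "x \<in> mspace E" "y \<in> mspace E" "a * mdist E x y < \<bar>f x - f y\<bar>"
      using lip_const_least(3)[OF f, of a] a by (meson leD leI)
    have "(\<lambda>k. \<bar>g k x - g k y\<bar>) \<longlonglongrightarrow> \<bar>f x - f y\<bar>"
      by (intro tendsto_intros conv xy)
    then have "eventually (\<lambda>k. a * mdist E x y < \<bar>g k x - g k y\<bar>) sequentially"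
      using xy(3) by (rule order_tendstoD)
    then show ?thesis
    proof (rule eventually_mono)
      fix k assume "a * mdist E x y < \<bar>g k x - g k y\<bar>"
      also have "\<dots> \<le> lip_const E (g k) * mdist E x y"
        using g xy(1,2) by (rule lip_const_least(2))
      finally show "a < lip_const E (g k)"
        by (rule mult_right_less_imp_less) simp
    qed
  qed
qed

text \<open>The same principle for the supremum norm, where one point is enough as a witness.\<close>

lemma sup_norm_tendsto:
  assumes ne: "mspace E \<noteq> {}" and g: "\<And>k. g k \<in> Lip_b E"
    and conv: "\<And>x. x \<in> mspace E \<Longrightarrow> (\<lambda>k. g k x) \<longlonglongrightarrow> f x"
    and le: "\<And>k. sup_norm E (g k) \<le> sup_norm E f"
  shows "(\<lambda>k. sup_norm E (g k)) \<longlonglongrightarrow> sup_norm E f"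
proof (rule order_tendstoI)
  fix a assume "sup_norm E f < a"
  then show "eventually (\<lambda>k. sup_norm E (g k) < a) sequentially"
    using le by (intro always_eventually allI) (metis le_less_trans)
next
  fix a assume "a < sup_norm E f"
  then obtain x where x: "x \<in> mspace E" "a < \<bar>f x\<bar>"
    using sup_norm_le[OF ne, of f a] by (meson leD leI)
  have "(\<lambda>k. \<bar>g k x\<bar>) \<longlonglongrightarrow> \<bar>f x\<bar>"
    by (intro tendsto_intros conv x)
  then have "eventually (\<lambda>k. a < \<bar>g k x\<bar>) sequentially"
    using x(2) by (rule order_tendstoD)
  then show "eventually (\<lambda>k. a < sup_norm E (g k)) sequentially"
    by (rule eventually_mono) (use abs_le_sup_norm[OF g x(1)] in \<open>metis less_le_trans\<close>)
qed

text \<open>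
  The common Lipschitz constant \<open>L\<close> controls both \<open>g k x - g k y\<close> and \<open>f x - f y\<close> for \<open>y\<close> in the
  dense set near \<open>x\<close>, uniformly in \<open>k\<close>.
\<close>

lemma pointwise_limit_from_dense:
  assumes dense: "mtopology_of E closure_of C = mspace E"
    and f: "\<And>x y. x \<in> mspace E \<Longrightarrow> y \<in> mspace E \<Longrightarrow> \<bar>f x - f y\<bar> \<le> L * mdist E x y"
    and g: "\<And>k x y. x \<in> mspace E \<Longrightarrow> y \<in> mspace E \<Longrightarrow> \<bar>g k x - g k y\<bar> \<le> L * mdist E x y"
    and conv: "\<And>y. y \<in> C \<Longrightarrow> (\<lambda>k. g k y) \<longlonglongrightarrow> f y"
    and x: "x \<in> mspace E"
  shows "(\<lambda>k. g k x) \<longlonglongrightarrow> (f x :: real)"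
proof (rule LIMSEQ_I)
  fix e :: real assume e: "0 < e"
  define \<delta> where "\<delta> = e / (3 * (\<bar>L\<bar> + 1))"
  have \<delta>: "0 < \<delta>" using e by (simp add: \<delta>_def)
  have "x \<in> mtopology_of E closure_of C"
    using dense x by simp
  then obtain y where y: "y \<in> C" "y \<in> mspace E" "mdist E x y < \<delta>"
    using \<delta> unfolding mtopology_of_def Metric_space.metric_closure_of[OF Metric_space_mspace_mdist]
    by (auto simp: Metric_space.in_mball[OF Metric_space_mspace_mdist])
  have "L * mdist E x y \<le> (\<bar>L\<bar> + 1) * \<delta>"
    using y by (intro mult_mono) auto
  also have "\<dots> = e / 3"
    by (simp add: \<delta>_def field_simps)
  finally have small: "L * mdist E x y \<le> e / 3" .
  obtain N where N: "\<And>k. N \<le> k \<Longrightarrow> \<bar>g k y - f y\<bar> < e / 3"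
    using LIMSEQ_D[OF conv[OF y(1)], of "e / 3"] e by auto
  have "norm (g k x - f x) < e" if "N \<le> k" for k
    using N[OF that] f[OF x y(2)] g[OF x y(2), of k] small
    unfolding real_norm_def by linarith
  then show "\<exists>N. \<forall>k\<ge>N. norm (g k x - f x) < e" by blast
qed

section \<open>Truncated minima of cones\<close>

text \<open>
  The innermost argument \<open>m\<close> of the fold performs the truncation from above and also covers the
  empty list.
\<close>

definition truncated_cones :: "'a metric \<Rightarrow> real \<Rightarrow> real \<Rightarrow> ('a \<times> real) list \<Rightarrow> 'a \<Rightarrow> real" where
  "truncated_cones E l m ps x = max (- m) (foldr min (map (\<lambda>(y, r). r + l * mdist E y x) ps) m)"

lemma foldr_min_le:
  fixes a :: real
  assumes "b \<in> set bs"
  shows "foldr min bs a \<le> b"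
  using assms by (induction bs) (auto simp: min_le_iff_disj)

lemma foldr_min_le_base: "foldr min bs a \<le> (a :: real)"
  by (induction bs) (auto simp: min_le_iff_disj)

lemma foldr_min_greatest:
  fixes a :: real
  assumes "z \<le> a" and "\<And>b. b \<in> set bs \<Longrightarrow> z \<le> b"
  shows "z \<le> foldr min bs a"
  using assms by (induction bs) auto

lemma abs_truncated_cones_le: "\<bar>truncated_cones E l m ps x\<bar> \<le> \<bar>m\<bar>"
  using foldr_min_le_base[of "map (\<lambda>(y, r). r + l * mdist E y x) ps" m]
  unfolding truncated_cones_def by linarith

text \<open>Each cone is \<open>\<bar>l\<bar>\<close>-Lipschitz by the triangle inequality, and \<open>min\<close>, \<open>max\<close> preserve this.\<close>

lemma truncated_cones_lipschitz:
  assumes ps: "fst ` set ps \<subseteq> mspace E" and x: "x \<in> mspace E" and z: "z \<in> mspace E"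
  shows "\<bar>truncated_cones E l m ps x - truncated_cones E l m ps z\<bar> \<le> \<bar>l\<bar> * mdist E x z"
proof -
  have "\<bar>foldr min (map (\<lambda>(y, r). r + l * mdist E y x) ps) m
        - foldr min (map (\<lambda>(y, r). r + l * mdist E y z) ps) m\<bar> \<le> \<bar>l\<bar> * mdist E x z"
    using ps
  proof (induction ps)
    case Nil
    then show ?case by simp
  next
    case (Cons p ps)
    obtain y r where p: "p = (y, r)" by (cases p)
    with Cons.prems have y: "y \<in> mspace E" by simp
    have "\<bar>mdist E y x - mdist E y z\<bar> \<le> mdist E x z"
      using mdist_triangle[OF y x z] mdist_triangle[OF y z x] mdist_commute[of E x z] by linarith
    then have "\<bar>l\<bar> * \<bar>mdist E y x - mdist E y z\<bar> \<le> \<bar>l\<bar> * mdist E x z"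
      by (intro mult_left_mono) auto
    then have "\<bar>l * mdist E y x - l * mdist E y z\<bar> \<le> \<bar>l\<bar> * mdist E x z"
      by (simp add: abs_mult flip: right_diff_distrib)
    moreover have "\<bar>foldr min (map (\<lambda>(y, r). r + l * mdist E y x) ps) m
        - foldr min (map (\<lambda>(y, r). r + l * mdist E y z) ps) m\<bar> \<le> \<bar>l\<bar> * mdist E x z"
      using Cons by simp
    ultimately show ?case
      unfolding p by simp
  qed
  then show ?thesis
    unfolding truncated_cones_def by linarith
qed

lemma truncated_cones_Lip_b:
  assumes "fst ` set ps \<subseteq> mspace E"
  shows "truncated_cones E l m ps \<in> Lip_b E"
  using LipI[OF truncated_cones_lipschitz[OF assms]] abs_truncated_cones_le by (rule Lip_bI)

text \<open>
  McShane's argument with errors. At an apex \<open>x\<close> its own cone bounds the minimum from above. From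
  below, the cone with apex \<open>y\<close> is at least about \<open>f y + L * d y x \<ge> f x\<close>; replacing \<open>f y\<close> by \<open>r y\<close>
  and \<open>L\<close> by the smaller slope \<open>l\<close> costs \<open>e\<close> each.
\<close>

lemma truncated_cones_close:
  assumes x: "x \<in> set ys" "x \<in> mspace E" and m: "\<bar>f x\<bar> \<le> m + e"
    and f: "\<And>y. y \<in> set ys \<Longrightarrow> \<bar>f x - f y\<bar> \<le> L * mdist E y x"
    and r: "\<And>y. y \<in> set ys \<Longrightarrow> \<bar>r y - f y\<bar> \<le> e"
    and l: "\<And>y. y \<in> set ys \<Longrightarrow> (L - l) * mdist E y x \<le> e"
  shows "\<bar>truncated_cones E l m (map (\<lambda>y. (y, r y)) ys) x - f x\<bar> \<le> 2 * e"
proof -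
  let ?bs = "map (\<lambda>(y, r). r + l * mdist E y x) (map (\<lambda>y. (y, r y)) ys)"
  have e: "0 \<le> e" using r[OF x(1)] by linarith
  have "r x \<in> set ?bs"
    using x by (force simp: image_iff)
  then have upper: "foldr min ?bs m \<le> r x"
    by (rule foldr_min_le)
  have "f x - 2 * e \<le> foldr min ?bs m"
  proof (rule foldr_min_greatest)
    show "f x - 2 * e \<le> m" using m e by linarith
    fix b assume "b \<in> set ?bs"
    then obtain y where y: "y \<in> set ys" "b = r y + l * mdist E y x" by auto
    then show "f x - 2 * e \<le> b"
      using f[OF y(1)] r[OF y(1)] l[OF y(1)] by (simp add: left_diff_distrib abs_le_iff)
  qed
  then show ?thesis
    using upper r[OF x(1)] m e unfolding truncated_cones_def by linarith
qed

section \<open>The countable family\<close>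

definition rational_cones :: "'a metric \<Rightarrow> (nat \<Rightarrow> 'a) \<Rightarrow> rat \<times> rat \<times> (nat \<times> rat) list \<Rightarrow> 'a \<Rightarrow> real" where
  "rational_cones E c = (\<lambda>(l, m, rs).
     truncated_cones E (of_rat l) (of_rat m) (map (\<lambda>(i, r). (c i, of_rat r)) rs))"

text \<open>The case \<open>a = 0\<close> is exact, so constant functions and the zero function need no special treatment.\<close>

lemma nonneg_rational_below:
  fixes a e :: real
  assumes "0 \<le> a" and "0 < e"
  obtains q :: rat where "0 \<le> q" "of_rat q \<le> a" "a - e \<le> of_rat q"
proof (cases "a = 0")
  case True
  then show ?thesis using assms that[of 0] by simp
next
  case False
  then obtain q where "max 0 (a - e) < of_rat q" "of_rat q < a"
    using assms of_rat_dense[of "max 0 (a - e)" a] by auto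
  then show ?thesis
    using that[of q] by (simp add: less_imp_le)
qed

lemma rational_near:
  fixes a e :: real
  assumes "0 < e"
  shows "\<exists>q :: rat. \<bar>of_rat q - a\<bar> \<le> e"
proof -
  obtain q where "a < of_rat q" "of_rat q < a + e"
    using of_rat_dense[of a "a + e"] assms by auto
  then show ?thesis
    by (intro exI[of _ q]) linarith
qed

lemma rational_cones_approximate:
  assumes f: "f \<in> Lip E" and c: "\<And>i. c i \<in> mspace E" and e: "0 < e"
  obtains j where
    "\<And>i. i \<le> (k :: nat) \<Longrightarrow> \<bar>rational_cones E c j (c i) - f (c i)\<bar> \<le> e"
    "lip_const E (rational_cones E c j) \<le> lip_const E f"
    "f \<in> Lip_b E \<Longrightarrow> sup_norm E (rational_cones E c j) \<le> sup_norm E f"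
proof -
  define e' where "e' = e / 2"
  have e': "0 < e'" using e by (simp add: e'_def)
  define D where "D = (\<Sum>i\<le>k. \<Sum>j\<le>k. mdist E (c i) (c j))"
  have D: "mdist E (c i) (c j) \<le> D" if "i \<le> k" "j \<le> k" for i j
  proof -
    have "mdist E (c i) (c j) \<le> (\<Sum>j\<le>k. mdist E (c i) (c j))"
      using that by (intro member_le_sum) auto
    also have "\<dots> \<le> D"
      unfolding D_def using that by (intro member_le_sum[of i]) (auto intro: sum_nonneg)
    finally show ?thesis .
  qed
  have D0: "0 \<le> D"
    unfolding D_def by (intro sum_nonneg) auto
  obtain l where l: "0 \<le> l" "of_rat l \<le> lip_const E f" "lip_const E f - e' / (D + 1) \<le> of_rat l"
    by (rule nonneg_rational_below[of "lip_const E f" "e' / (D + 1)"])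
      (use lip_const_least(1)[OF f] e' D0 in auto)
  \<comment> \<open>The truncation level approximates the norm of \<open>f\<close> from below when \<open>f\<close> is bounded; otherwise
    it only has to dominate the finitely many values at hand.\<close>
  define B where "B = (if f \<in> Lip_b E then sup_norm E f else (\<Sum>i\<le>k. \<bar>f (c i)\<bar>))"
  have B: "\<bar>f (c i)\<bar> \<le> B" if "i \<le> k" for i
  proof (cases "f \<in> Lip_b E")
    case True
    then show ?thesis using abs_le_sup_norm[OF True c] by (simp add: B_def)
  next
    case False
    have "\<bar>f (c i)\<bar> \<le> (\<Sum>i\<le>k. \<bar>f (c i)\<bar>)"
      using that by (intro member_le_sum[of i]) auto
    then show ?thesis using False by (simp add: B_def)
  qed
  have "0 \<le> B" using B[of 0] by linarith
  then obtain m where m: "0 \<le> m" "of_rat m \<le> B" "B - e' \<le> of_rat m"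
    using nonneg_rational_below[OF _ e', of B] by metis
  have "\<exists>r. \<forall>y. \<bar>of_rat (r y) - f y\<bar> \<le> e'"
    by (intro choice allI rational_near e')
  then obtain r :: "'a \<Rightarrow> rat" where r: "\<And>y. \<bar>of_rat (r y) - f y\<bar> \<le> e'"
    by blast
  define ys where "ys = map c [0..<Suc k]"
  have ys: "y \<in> set ys \<longleftrightarrow> (\<exists>i\<le>k. y = c i)" for y
    by (auto simp: ys_def less_Suc_eq_le image_iff simp del: upt_Suc)
  define j where "j = (l, m, map (\<lambda>i. (i, r (c i))) [0..<Suc k])"
  have j: "rational_cones E c j
      = truncated_cones E (of_rat l) (of_rat m) (map (\<lambda>y. (y, of_rat (r y))) ys)"
    by (simp add: rational_cones_def j_def ys_def o_def del: upt_Suc)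
  show thesis
  proof (rule that[of j])
    fix i assume i: "i \<le> k"
    have "\<bar>rational_cones E c j (c i) - f (c i)\<bar> \<le> 2 * e'"
      unfolding j
    proof (rule truncated_cones_close)
      show "c i \<in> set ys" using i ys by blast
      show "\<bar>f (c i)\<bar> \<le> of_rat m + e'" using B[OF i] m(3) by linarith
      fix y assume "y \<in> set ys"
      then obtain n where n: "n \<le> k" "y = c n" using ys by blast
      show "\<bar>f (c i) - f y\<bar> \<le> lip_const E f * mdist E y (c i)"
        using lip_const_least(2)[OF f c c, of i n] by (simp add: n mdist_commute)
      have "(lip_const E f - of_rat l) * mdist E y (c i) \<le> e' / (D + 1) * (D + 1)"
        using l(3) D[OF n(1) i] e' D0 l(2) unfolding n(2) by (intro mult_mono) auto
      then show "(lip_const E f - of_rat l) * mdist E y (c i) \<le> e'"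
        using D0 by simp
    qed (use c r in auto)
    then show "\<bar>rational_cones E c j (c i) - f (c i)\<bar> \<le> e"
      by (simp add: e'_def)
  next
    have sub: "fst ` set (map (\<lambda>y. (y, real_of_rat (r y))) ys) \<subseteq> mspace E"
      using c by (auto simp: ys)
    have "truncated_cones E (of_rat l) (of_rat m) (map (\<lambda>y. (y, of_rat (r y))) ys) \<in> Lip E"
      using truncated_cones_Lip_b[OF sub] by (simp add: Lip_b_def)
    moreover have "\<bar>of_rat l :: real\<bar> = of_rat l"
      using l(1) by simp
    ultimately have "lip_const E (rational_cones E c j) \<le> of_rat l"
      using truncated_cones_lipschitz[OF sub, where l = "of_rat l"] l(1) unfolding j
      by (intro lip_const_least(3)) simp_all
    then show "lip_const E (rational_cones E c j) \<le> lip_const E f"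
      using l(2) by linarith
  next
    assume "f \<in> Lip_b E"
    then have "of_rat m \<le> sup_norm E f" using m(2) by (simp add: B_def)
    moreover have "sup_norm E (rational_cones E c j) \<le> of_rat m"
      using c abs_truncated_cones_le[of E "of_rat l" "of_rat m"] m(1)
      by (intro sup_norm_le) (auto simp: j)
    ultimately show "sup_norm E (rational_cones E c j) \<le> sup_norm E f" by linarith
  qed
qed

text \<open>
  An enumeration \<open>e\<close> in which every value recurs infinitely often: any sequence of values can then be
  realised along strictly increasing indices.
\<close>

lemma recurrent_enumeration:
  obtains e :: "nat \<Rightarrow> 'b :: countable" where
    "\<And>j. \<exists>s :: nat \<Rightarrow> nat. strict_mono s \<and> (\<forall>k. e (s k) = j k)"
proof (rule that)
  fix j :: "nat \<Rightarrow> 'b"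
  let ?e = "\<lambda>n. from_nat (fst (prod_decode n)) :: 'b"
  have recur: "\<exists>n>N. ?e n = b" for b N
    by (rule exI[of _ "prod_encode (to_nat b, Suc N)"])
      (simp add: less_le_trans[OF _ le_prod_encode_2])
  have "\<exists>s. \<forall>k. ?e (s k) = j k \<and> s k < s (Suc k)"
    by (rule dependent_nat_choice) (use recur in \<open>auto\<close>)
  then show "\<exists>s :: nat \<Rightarrow> nat. strict_mono s \<and> (\<forall>k. ?e (s k) = j k)"
    by (auto simp: strict_mono_Suc_iff)
qed

section \<open>Separability of the space of Lipschitz functions\<close>

theorem lemmaA1:
  fixes E :: "'a metric"
  assumes "mcomplete_of E"
    and "separable_space (mtopology_of E)"
  shows "\<exists>p :: nat \<Rightarrow> 'a \<Rightarrow> real.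
    (\<forall>n. p n \<in> Lip_b E) \<and>
    (\<forall>\<pi> \<in> Lip E.
       \<exists>s :: nat \<Rightarrow> nat. strict_mono s \<and>
         (\<forall>x \<in> mspace E. (\<lambda>k. p (s k) x) \<longlonglongrightarrow> \<pi> x) \<and>
         (\<lambda>k. lip_const E (p (s k))) \<longlonglongrightarrow> lip_const E \<pi> \<and>
         (\<forall>k. lip_const E (p (s k)) \<le> lip_const E \<pi>) \<and>
         (\<pi> \<in> Lip_b E \<longrightarrow>
            (\<forall>k. sup_norm E (p (s k)) \<le> sup_norm E \<pi>) \<and>
            (\<lambda>k. sup_norm E (p (s k))) \<longlonglongrightarrow> sup_norm E \<pi>))"
proof (cases "mspace E = {}")
  case True
  have lip0: "lip_const E f = 0" for f
    using True by (simp add: lip_const_def flip: atLeast_def)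
  have sup0: "sup_norm E f = Sup {}" for f
    using True by (simp add: sup_norm_def)
  have "(\<lambda>_. 0) \<in> Lip_b E"
    by (rule Lip_bI[of _ _ 0], rule LipI[of _ _ 0]) auto
  then show ?thesis
    using True
    by (intro exI[of _ "\<lambda>_ _. 0"] conjI ballI allI exI[of _ id])
      (simp_all add: lip0 sup0 strict_mono_def)
next
  case False
  obtain C where C: "countable C" "C \<subseteq> mspace E" "mtopology_of E closure_of C = mspace E"
    using assms(2) by (auto simp: separable_space_def)
  then have "C \<noteq> {}" using False by auto
  define c where "c = from_nat_into C"
  have range_c: "range c = C"
    using \<open>C \<noteq> {}\<close> C(1) by (simp add: c_def)
  have c: "c i \<in> mspace E" for i
    using range_c C(2) by blast
  have Lip_b: "rational_cones E c j \<in> Lip_b E" for j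
  proof (cases j)
    case (fields l m rs)
    then show ?thesis
      using c by (auto simp: rational_cones_def intro!: truncated_cones_Lip_b)
  qed
  then have Lip: "rational_cones E c j \<in> Lip E" for j
    by (simp add: Lip_b_def)
  obtain e :: "nat \<Rightarrow> rat \<times> rat \<times> (nat \<times> rat) list" where
    e: "\<And>j. \<exists>s :: nat \<Rightarrow> nat. strict_mono s \<and> (\<forall>k. e (s k) = j k)"
    by (rule recurrent_enumeration) blast
  show ?thesis
  proof (intro exI[of _ "\<lambda>n. rational_cones E c (e n)"] conjI allI ballI)
    show "rational_cones E c (e n) \<in> Lip_b E" for n
      by (rule Lip_b)
    fix \<pi> assume \<pi>: "\<pi> \<in> Lip E"
    have "\<exists>j. (\<forall>i\<le>k. \<bar>rational_cones E c j (c i) - \<pi> (c i)\<bar> \<le> inverse (real (Suc k)))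
        \<and> lip_const E (rational_cones E c j) \<le> lip_const E \<pi>
        \<and> (\<pi> \<in> Lip_b E \<longrightarrow> sup_norm E (rational_cones E c j) \<le> sup_norm E \<pi>)" for k
    proof (rule rational_cones_approximate[where c = c and k = k])
      show "0 < inverse (real (Suc k))" by simp
    qed (use \<pi> c in blast)+
    then obtain j where
      close: "\<And>k i. i \<le> k \<Longrightarrow> \<bar>rational_cones E c (j k) (c i) - \<pi> (c i)\<bar> \<le> inverse (real (Suc k))"
      and lip: "\<And>k. lip_const E (rational_cones E c (j k)) \<le> lip_const E \<pi>"
      and norm: "\<And>k. \<pi> \<in> Lip_b E \<Longrightarrow> sup_norm E (rational_cones E c (j k)) \<le> sup_norm E \<pi>"
      by metis
    have dense_conv: "(\<lambda>k. rational_cones E c (j k) y) \<longlonglongrightarrow> \<pi> y" if "y \<in> C" for y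
    proof -
      obtain i where i: "y = c i" using \<open>y \<in> C\<close> range_c by blast
      have "(\<lambda>k. rational_cones E c (j k) (c i) - \<pi> (c i)) \<longlonglongrightarrow> 0"
        by (rule Lim_null_comparison[OF _ LIMSEQ_inverse_real_of_nat])
          (use close in \<open>auto intro!: eventually_sequentiallyI[of i]\<close>)
      then show ?thesis unfolding i by (rule LIM_zero_cancel)
    qed
    have lipschitz: "\<bar>rational_cones E c (j k) x - rational_cones E c (j k) y\<bar>
        \<le> lip_const E \<pi> * mdist E x y" if "x \<in> mspace E" "y \<in> mspace E" for k x y
      using lip_const_least(2)[OF Lip that, of "j k"] mult_right_mono[OF lip, of "mdist E x y" k]
      by simp
    have conv: "(\<lambda>k. rational_cones E c (j k) x) \<longlonglongrightarrow> \<pi> x" if "x \<in> mspace E" for x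
      using C(3) lip_const_least(2)[OF \<pi>] lipschitz dense_conv that
      by (rule pointwise_limit_from_dense)
    obtain s :: "nat \<Rightarrow> nat" where s: "strict_mono s" "\<And>k. e (s k) = j k"
      using e[of j] by blast
    show "\<exists>s. strict_mono s \<and>
         (\<forall>x\<in>mspace E. (\<lambda>k. rational_cones E c (e (s k)) x) \<longlonglongrightarrow> \<pi> x) \<and>
         (\<lambda>k. lip_const E (rational_cones E c (e (s k)))) \<longlonglongrightarrow> lip_const E \<pi> \<and>
         (\<forall>k. lip_const E (rational_cones E c (e (s k))) \<le> lip_const E \<pi>) \<and>
         (\<pi> \<in> Lip_b E \<longrightarrow>
            (\<forall>k. sup_norm E (rational_cones E c (e (s k))) \<le> sup_norm E \<pi>) \<and>
            (\<lambda>k. sup_norm E (rational_cones E c (e (s k)))) \<longlonglongrightarrow> sup_norm E \<pi>)"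
    proof (intro exI[of _ s] conjI impI allI ballI, unfold s(2))
      show "(\<lambda>k. lip_const E (rational_cones E c (j k))) \<longlonglongrightarrow> lip_const E \<pi>"
        using \<pi> Lip conv lip by (rule lip_const_tendsto)
      show "(\<lambda>k. sup_norm E (rational_cones E c (j k))) \<longlonglongrightarrow> sup_norm E \<pi>" if "\<pi> \<in> Lip_b E"
        using False Lip_b conv norm[OF that] by (rule sup_norm_tendsto)
    qed (use s(1) conv lip norm in auto)
  qed
qed

end
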